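(* Let $K$ be a compact metrizable space, let $\mathcal{M} \subset B_{C(K)^*}$ be a $w^*$-compact set of positive measures on $K$ and let $(f_n)$ be a normalized weakly null sequence in $C(K)$. Suppose that there exist a scalar $\rho > 0$, a sequence of positive scalars $(\epsilon_n)$ and an infinite subset $N$ of $\mathbb{N}$ such that for every infinite subset $L$ of $N$, with increasing enumeration $L= (l_i)_{i\ge 1}$, and all $n \in \mathbb{N}$ there exists some $\mu \in \mathcal{M}$ satisfying $$\mu([|f_{l_{2i}}| \geq \epsilon_{l_{2i-1}}]) \geq \rho \quad\text{for all } i \leq n.$$ Then $\mathcal{M}$ is not separable in norm (i.e. in the norm topology of $C(K)^*$).
   Context: $C(K)$ is the real Banach space of continuous functions on $K$ with the supremum norm; $C(K)^*$ is identified with the space of finite signed regular Borel measures on $K$ with total variation norm, and $B_{C(K)^*}$ is its closed unit ball. Normalized means $\|f_n\|=1$ for all $n$. For $f\in C(K)$ and $\epsilon>0$, $[|f|\ge\epsilon]=\{t\in K: |f(t)|\ge\epsilon\}$. *)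

theory Defs
  imports "HOL-Analysis.Analysis"
begin

text \<open>
  The compact space \<open>K\<close> is the universe of a type \<open>'a\<close>.  Continuous functions on a compact space
  are bounded, so \<open>C(K)\<close> with the supremum norm is the type \<open>'a \<Rightarrow>\<^sub>C real\<close>, and
  its Banach dual with the operator norm is \<open>('a \<Rightarrow>\<^sub>C real) \<Rightarrow>\<^sub>L real\<close>.
\<close>

definition weakly_null :: "(nat \<Rightarrow> 'v::real_normed_vector) \<Rightarrow> bool" where
  "weakly_null f \<longleftrightarrow> (\<forall>\<phi> :: 'v \<Rightarrow>\<^sub>L real. (\<lambda>n. blinfun_apply \<phi> (f n)) \<longlonglongrightarrow> 0)"

text \<open>
  For scalar-valued functionals the strong operator topology, that is, the topology of pointwise
  convergence, is the weak* topology.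
\<close>

definition weak_star_topology :: "('v::real_normed_vector \<Rightarrow>\<^sub>L real) topology" where
  "weak_star_topology = strong_operator_topology"

text \<open>
  Regularity is automatic for finite Borel measures on a compact metrizable space; it is kept here
  because it is part of the description of the dual of \<open>C(K)\<close>.
\<close>

definition regular_borel_measure :: "'a::topological_space measure \<Rightarrow> bool" where
  "regular_borel_measure \<mu> \<longleftrightarrow>
     sets \<mu> = sets borel \<and>
     (\<forall>A \<in> sets borel. emeasure \<mu> A = (SUP C \<in> {C. compact C \<and> C \<subseteq> A}. emeasure \<mu> C)) \<and>
     (\<forall>A \<in> sets borel. emeasure \<mu> A = (INF U \<in> {U. open U \<and> A \<subseteq> U}. emeasure \<mu> U))"

definition positive_measures :: "'a::topological_space measure set" where
  "positive_measures = {\<mu>. finite_measure \<mu> \<and> regular_borel_measure \<mu>}"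

text \<open>
  The identification of a finite positive measure with an element of the dual of \<open>C(K)\<close>.
\<close>

definition measure_functional ::
    "'a::topological_space measure \<Rightarrow> ('a \<Rightarrow>\<^sub>C real) \<Rightarrow>\<^sub>L real" where
  "measure_functional \<mu> = Blinfun (\<lambda>f. \<integral>t. apply_bcontfun f t \<partial>\<mu>)"

lemma integrable_bcontfun:
  fixes f :: "'a::topological_space \<Rightarrow>\<^sub>C real"
  assumes "\<mu> \<in> positive_measures"
  shows "integrable \<mu> (apply_bcontfun f)"
proof -
  interpret finite_measure \<mu>
    using assms by (simp add: positive_measures_def)
  have sets: "sets \<mu> = sets borel"
    using assms by (simp add: positive_measures_def regular_borel_measure_def)
  have "apply_bcontfun f \<in> borel_measurable borel"
    by (intro borel_measurable_continuous_onI) simp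
  then have "apply_bcontfun f \<in> borel_measurable \<mu>"
    using measurable_cong_sets[OF sets refl] by blast
  then show ?thesis
    by (intro integrable_const_bound[where B = "norm f"]) (auto simp flip: real_norm_def intro: norm_bounded)
qed

lemma measure_functional_apply:
  fixes f :: "'a::topological_space \<Rightarrow>\<^sub>C real"
  assumes "\<mu> \<in> positive_measures"
  shows "blinfun_apply (measure_functional \<mu>) f = (\<integral>t. apply_bcontfun f t \<partial>\<mu>)"
proof -
  interpret finite_measure \<mu>
    using assms by (simp add: positive_measures_def)
  have int: "integrable \<mu> (apply_bcontfun g)" for g :: "'a \<Rightarrow>\<^sub>C real"
    by (rule integrable_bcontfun[OF assms])
  have "bounded_linear (\<lambda>f :: 'a \<Rightarrow>\<^sub>C real. \<integral>t. apply_bcontfun f t \<partial>\<mu>)"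
  proof (rule bounded_linear_intro)
    fix f g :: "'a \<Rightarrow>\<^sub>C real" and r :: real
    show "(\<integral>t. apply_bcontfun (f + g) t \<partial>\<mu>) =
        (\<integral>t. apply_bcontfun f t \<partial>\<mu>) + (\<integral>t. apply_bcontfun g t \<partial>\<mu>)"
      using int by (simp add: plus_bcontfun.rep_eq)
    show "(\<integral>t. apply_bcontfun (r *\<^sub>R f) t \<partial>\<mu>) = r *\<^sub>R (\<integral>t. apply_bcontfun f t \<partial>\<mu>)"
      by (simp add: scaleR_bcontfun.rep_eq)
    have "norm (\<integral>t. apply_bcontfun f t \<partial>\<mu>) \<le> (\<integral>t. norm (apply_bcontfun f t) \<partial>\<mu>)"
      by (rule integral_norm_bound)
    also have "\<dots> \<le> (\<integral>t. norm f \<partial>\<mu>)"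
      by (rule integral_mono) (use int norm_bounded[of f] in \<open>auto intro: integrable_abs\<close>)
    also have "\<dots> = norm f * measure \<mu> (space \<mu>)"
      by simp
    finally show "norm (\<integral>t. apply_bcontfun f t \<partial>\<mu>) \<le> norm f * measure \<mu> (space \<mu>)" .
  qed
  then show ?thesis
    by (simp add: measure_functional_def bounded_linear_Blinfun_apply)
qed

text \<open>
  The increasing enumeration \<open>l\<^sub>1 < l\<^sub>2 < \<dots>\<close> of an infinite set, with indices starting at 1
  (the library's \<open>enumerate\<close> starts at 0).
\<close>

definition enum1 :: "nat set \<Rightarrow> nat \<Rightarrow> nat" where
  "enum1 L i = enumerate L (i - 1)"

end

theory Submission
  imports Defs
begin

text \<open>
  Suppose \<open>M\<close> is norm separable, with a dense sequence \<open>(\<mu>\<^sub>k)\<close>.  A weakly null sequence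
  tends to \<open>0\<close> pointwise, so \<open>\<integral> min 1 (\<bar>f\<^sub>n\<bar> / \<epsilon>) \<partial>\<mu>\<^sub>k\<close> tends to \<open>0\<close> for every \<open>k\<close> and \<open>\<epsilon> > 0\<close>.  Hence some
  \<open>l\<^sub>1 < l\<^sub>2 < \<dots>\<close> in \<open>N\<close> is so sparse that the functions \<open>g\<^sub>i = min 1 (\<bar>f (l\<^sub>2\<^sub>i)\<bar> / \<epsilon> (l\<^sub>2\<^sub>i\<^sub>-\<^sub>1))\<close> satisfy
  \<open>\<integral> g\<^sub>i \<partial>\<mu>\<^sub>k < \<rho> / 2\<close> for all \<open>i > k\<close>.  By weak* compactness there is a single \<open>\<mu> \<in> M\<close> with
  \<open>\<integral> g\<^sub>i \<partial>\<mu> \<ge> \<rho>\<close> for all \<open>i\<close>, and since \<open>\<parallel>g\<^sub>i\<parallel> \<le> 1\<close> this \<open>\<mu>\<close> has distance at least \<open>\<rho> / 2\<close> from every \<open>\<mu>\<^sub>k\<close>.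
\<close>

text \<open>For \<open>e > 0\<close> this is a continuous majorant of the indicator of
  \<open>{t. \<bar>h t\<bar> \<ge> e}\<close>. Unlike the indicator it lies in \<open>C(K)\<close>,
  so functionals and weak* limits can be tested on it.\<close>

definition capped_quotient ::
    "('a::topological_space \<Rightarrow>\<^sub>C real) \<Rightarrow> real \<Rightarrow> 'a \<Rightarrow>\<^sub>C real" where
  "capped_quotient h e = Bcontfun (\<lambda>t. min 1 (\<bar>apply_bcontfun h t\<bar> / e))"

lemma capped_quotient_apply:
  assumes "e > 0"
  shows "apply_bcontfun (capped_quotient h e) t = min 1 (\<bar>apply_bcontfun h t\<bar> / e)"
proof -
  have "(\<lambda>t. min 1 (\<bar>apply_bcontfun h t\<bar> / e)) \<in> bcontfun"
    using assms
    by (intro bcontfun_normI[where b = 1] continuous_intros) auto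
  then show ?thesis
    by (simp add: capped_quotient_def Bcontfun_inverse)
qed

lemma norm_capped_quotient_le_1: "e > 0 \<Longrightarrow> norm (capped_quotient h e) \<le> 1"
  by (rule norm_bound) (simp add: capped_quotient_apply)

lemma measure_le_functional_capped_quotient:
  assumes \<mu>: "\<mu> \<in> positive_measures" and e: "e > 0"
  shows "measure \<mu> {t. \<bar>apply_bcontfun h t\<bar> \<ge> e}
    \<le> blinfun_apply (measure_functional \<mu>) (capped_quotient h e)"
proof -
  interpret finite_measure \<mu>
    using \<mu> by (simp add: positive_measures_def)
  have sets: "sets \<mu> = sets borel"
    using \<mu> by (simp add: positive_measures_def regular_borel_measure_def)
  let ?A = "{t. \<bar>apply_bcontfun h t\<bar> \<ge> e}"
  have "closed ?A"
    by (intro closed_Collect_le continuous_intros) simp_all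
  then have A: "?A \<in> sets \<mu>"
    using sets by simp
  have "measure \<mu> ?A = (\<integral>t. indicator ?A t \<partial>\<mu>)"
    using A sets.sets_into_space by (simp add: Int_absorb2)
  also have "\<dots> \<le> (\<integral>t. apply_bcontfun (capped_quotient h e) t \<partial>\<mu>)"
    using A e integrable_bcontfun[OF \<mu>]
    by (intro integral_mono)
      (auto simp: capped_quotient_apply le_divide_eq less_top[symmetric] split: split_indicator)
  finally show ?thesis
    by (simp add: measure_functional_apply[OF \<mu>])
qed

lemma weakly_null_pointwise:
  assumes "weakly_null f"
  shows "(\<lambda>n. apply_bcontfun (f n) t :: real) \<longlonglongrightarrow> 0"
proof -
  have "bounded_linear (\<lambda>h :: 'a \<Rightarrow>\<^sub>C real. apply_bcontfun h t)"
    by (rule bounded_linear_intro[where K = 1])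
      (auto simp: plus_bcontfun.rep_eq scaleR_bcontfun.rep_eq simp flip: real_norm_def
        intro: norm_bounded)
  then show ?thesis
    using assms[unfolded weakly_null_def, rule_format, of "Blinfun (\<lambda>h. apply_bcontfun h t)"]
    by (simp add: bounded_linear_Blinfun_apply)
qed

text \<open>Dominated convergence: the integrands tend to 0 pointwise, and the constant 1 is
  integrable because \<open>\<mu>\<close> is finite.\<close>

lemma functional_capped_quotient_tendsto_0:
  assumes \<mu>: "\<mu> \<in> positive_measures" and f: "weakly_null f" and e: "e > 0"
  shows "(\<lambda>n. blinfun_apply (measure_functional \<mu>) (capped_quotient (f n) e)) \<longlonglongrightarrow> 0"
proof -
  interpret finite_measure \<mu>
    using \<mu> by (simp add: positive_measures_def)
  have pointwise: "(\<lambda>n. apply_bcontfun (capped_quotient (f n) e) t) \<longlonglongrightarrow> 0" for t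
  proof -
    have "(\<lambda>n. min 1 (\<bar>apply_bcontfun (f n) t\<bar> / e)) \<longlonglongrightarrow> min 1 (\<bar>0\<bar> / e)"
      by (intro tendsto_intros weakly_null_pointwise[OF f]) (use e in auto)
    then show ?thesis
      by (simp add: capped_quotient_apply[OF e])
  qed
  have "(\<lambda>n. \<integral>t. apply_bcontfun (capped_quotient (f n) e) t \<partial>\<mu>) \<longlonglongrightarrow> (\<integral>t. 0 \<partial>\<mu>)"
  proof (rule integral_dominated_convergence[where w = "\<lambda>_. 1"])
    show "AE t in \<mu>. norm (apply_bcontfun (capped_quotient (f n) e) t) \<le> 1" for n
      using e by (simp add: capped_quotient_apply)
  qed (use pointwise integrable_bcontfun[OF \<mu>] in auto)
  then show ?thesis
    by (simp add: measure_functional_apply[OF \<mu>])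
qed

lemma enumerate_range_strict_mono:
  fixes l :: "nat \<Rightarrow> nat"
  assumes l: "strict_mono l"
  shows "enumerate (range l) n = l n"
proof (induction n rule: less_induct)
  case (less n)
  have inf: "infinite (range l)"
    using l by (simp add: range_inj_infinite strict_mono_imp_inj_on)
  show ?case
  proof (cases n)
    case 0
    then show ?thesis
      using l by (auto simp: enumerate_0 strict_mono_less_eq intro!: Least_equality)
  next
    case (Suc m)
    then have "enumerate (range l) n = (LEAST s. s \<in> range l \<and> l m < s)"
      using enumerate_Suc''[OF inf, of m] less.IH[of m] by simp
    also have "\<dots> = l n"
      using l Suc by (intro Least_equality) (auto simp: strict_mono_less strict_mono_less_eq)
    finally show ?thesis .
  qed
qed

text \<open>Dependent choice: each requirement involves only the stage and two consecutive terms,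
  and all large \<open>y\<close> meet it, so the infinite set \<open>N\<close> always offers a next
  term.\<close>

lemma sparse_sequence:
  fixes N :: "nat set"
  assumes "infinite N" and Q: "\<And>n x. \<forall>\<^sub>F y in sequentially. Q n x y"
  obtains l where "strict_mono l" "range l \<subseteq> N" "\<And>n. Q n (l n) (l (Suc n))"
proof -
  have "\<exists>y. y \<in> N \<and> x < y \<and> Q n x y" for n x
  proof -
    obtain m where "\<And>y. y \<ge> m \<Longrightarrow> Q n x y"
      using Q[of n x] unfolding eventually_sequentially by blast
    moreover obtain y where "y \<in> N" "y > max m x"
      using \<open>infinite N\<close> unfolding infinite_nat_iff_unbounded by blast
    ultimately show ?thesis
      by (intro exI[of _ y]) auto
  qed
  moreover have "\<exists>x. x \<in> N"
    using \<open>infinite N\<close> not_finite_existsD by fastforce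
  ultimately obtain l where "\<And>n. l n \<in> N" "\<And>n. l n < l (Suc n) \<and> Q n (l n) (l (Suc n))"
    using dependent_nat_choice[of "\<lambda>_ x. x \<in> N" "\<lambda>n x y. x < y \<and> Q n x y"] by blast
  then show ?thesis
    by (intro that[of l]) (auto simp: strict_mono_Suc_iff)
qed

text \<open>Finite intersection property: evaluation at \<open>g i\<close> is weak* continuous, so
  each constraint is a closed set, and finitely many constraints have all their indices below some
  \<open>n\<close>.\<close>

lemma weak_star_compact_attains_lower_bounds:
  fixes S :: "('v::real_normed_vector \<Rightarrow>\<^sub>L real) set"
  assumes S: "compactin weak_star_topology S"
    and fin: "\<And>n::nat. \<exists>\<phi>\<in>S. \<forall>i<n. blinfun_apply \<phi> (g i) \<ge> c"
  shows "\<exists>\<phi>\<in>S. \<forall>i. blinfun_apply \<phi> (g i) \<ge> c"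
proof -
  define H where "H i = {\<phi>. blinfun_apply \<phi> (g i) \<ge> c}" for i
  have "closedin weak_star_topology (H i)" for i
  proof -
    have "closedin weak_star_topology
        {\<phi> \<in> topspace weak_star_topology. blinfun_apply \<phi> (g i) \<in> {c..}}"
      unfolding weak_star_topology_def
      by (rule closedin_continuous_map_preimage[OF
            strong_operator_topology_continuous_evaluation]) simp
    then show ?thesis
      by (simp add: H_def weak_star_topology_def strong_operator_topology_topspace)
  qed
  moreover have "S \<inter> \<Inter>\<F> \<noteq> {}" if \<F>: "finite \<F>" "\<F> \<subseteq> range H" for \<F>
  proof -
    obtain I where I: "finite I" "\<F> = H ` I"
      using finite_subset_image[OF \<F>] by blast
    obtain n where "\<forall>i\<in>I. i < n"
      using I(1) finite_nat_set_iff_bounded[of I] by auto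
    moreover obtain \<phi> where "\<phi> \<in> S" "\<forall>i<n. blinfun_apply \<phi> (g i) \<ge> c"
      using fin by blast
    ultimately have "\<phi> \<in> S \<inter> \<Inter>\<F>"
      using I(2) by (simp add: H_def)
    then show ?thesis
      by blast
  qed
  ultimately have "S \<inter> \<Inter>(range H) \<noteq> {}"
    using S[unfolded compactin_fip, THEN conjunct2, rule_format, of "range H"] by auto
  then show ?thesis
    by (auto simp: H_def)
qed

theorem theorem1p2:
  fixes M :: "'a::topological_space measure set"
    and f :: "nat \<Rightarrow> ('a \<Rightarrow>\<^sub>C real)"
    and \<rho> :: real
    and \<epsilon> :: "nat \<Rightarrow> real"
    and N :: "nat set"
  assumes "compact (UNIV :: 'a set)"
    and "metrizable_space (euclidean :: 'a topology)"
    and "M \<subseteq> positive_measures"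
    and "measure_functional ` M \<subseteq> cball 0 1"
    and "compactin weak_star_topology (measure_functional ` M)"
    and "\<And>n. norm (f n) = 1"
    and "weakly_null f"
    and "\<rho> > 0"
    and "\<And>n. \<epsilon> n > 0"
    and "infinite N"
    and "\<And>L n. L \<subseteq> N \<Longrightarrow> infinite L \<Longrightarrow>
           \<exists>\<mu>\<in>M. \<forall>i\<in>{1..n}.
             measure \<mu> {t. \<bar>apply_bcontfun (f (enum1 L (2 * i))) t\<bar> \<ge> \<epsilon> (enum1 L (2 * i - 1))} \<ge> \<rho>"
  shows "\<not> separable_space (subtopology euclidean (measure_functional ` M))"
proof
  assume "separable_space (subtopology euclidean (measure_functional ` M))"
  then obtain C where C: "countable C" "C \<subseteq> measure_functional ` M"
      "measure_functional ` M \<subseteq> closure C"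
    unfolding separable_space_def closure_of_subtopology
    by (auto simp: Int_absorb1)
  \<comment> \<open>For \<open>n = 0\<close> the condition on \<open>i\<close> is vacuous, but the
    hypothesis still supplies a measure.\<close>
  have "M \<noteq> {}"
    using assms(10) assms(11)[of N 0] by auto
  with C have "C \<noteq> {}"
    by auto
  define D where "D = from_nat_into C"
  have D: "range D = C"
    unfolding D_def using \<open>C \<noteq> {}\<close> C(1) by (rule range_from_nat_into)
  have D_null: "(\<lambda>n. blinfun_apply (D k) (capped_quotient (f n) e)) \<longlonglongrightarrow> 0" if "e > 0" for k e
  proof -
    obtain \<mu> where "\<mu> \<in> M" "D k = measure_functional \<mu>"
      using C(2) D by blast
    with assms(3,7) that show ?thesis
      using functional_capped_quotient_tendsto_0 by auto
  qed
  \<comment> \<open>Stage \<open>n\<close> controls only \<open>D 0, ..., D n\<close>: finitely many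
    eventual conditions hold jointly. The threshold comes from the preceding term
    \<open>x\<close>.\<close>
  define Q where "Q n x y \<longleftrightarrow>
      (\<forall>k\<in>{..n}. blinfun_apply (D k) (capped_quotient (f y) (\<epsilon> x)) < \<rho> / 2)" for n x y
  have "\<forall>\<^sub>F y in sequentially. Q n x y" for n x
    unfolding Q_def using order_tendstoD(2)[OF D_null[OF assms(9)], of "\<rho> / 2"] assms(8)
    by (intro eventually_ball_finite) auto
  with assms(10) obtain l where l: "strict_mono l" "range l \<subseteq> N"
    and small: "\<And>n. Q n (l n) (l (Suc n))"
    using sparse_sequence[of N Q] by blast
  define g where "g i = capped_quotient (f (l (2 * i + 1))) (\<epsilon> (l (2 * i)))" for i
  have inf: "infinite (range l)"
    using l(1) by (simp add: range_inj_infinite strict_mono_imp_inj_on)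
  have "\<exists>\<phi>\<in>measure_functional ` M. \<forall>i<n. blinfun_apply \<phi> (g i) \<ge> \<rho>" for n
  proof -
    obtain \<mu> where \<mu>: "\<mu> \<in> M" and large: "\<And>i. i \<in> {1..n} \<Longrightarrow>
        measure \<mu> {t. \<bar>apply_bcontfun (f (enum1 (range l) (2 * i))) t\<bar>
          \<ge> \<epsilon> (enum1 (range l) (2 * i - 1))} \<ge> \<rho>"
      using assms(11)[OF l(2) inf, of n] by blast
    have "blinfun_apply (measure_functional \<mu>) (g i) \<ge> \<rho>" if "i < n" for i
    proof -
      have "\<rho> \<le> measure \<mu> {t. \<bar>apply_bcontfun (f (l (2 * i + 1))) t\<bar> \<ge> \<epsilon> (l (2 * i))}"
        \<comment> \<open>Since \<open>l\<close> starts at index 0, the pair of 1-based positions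
          \<open>2 * Suc i - 1\<close> and \<open>2 * Suc i\<close> is \<open>l (2 * i)\<close> and
          \<open>l (2 * i + 1)\<close>.\<close>
        using large[of "Suc i"] that by (simp add: enum1_def enumerate_range_strict_mono[OF l(1)])
      also have "\<dots> \<le> blinfun_apply (measure_functional \<mu>) (g i)"
        unfolding g_def using assms(3,9) \<mu> by (intro measure_le_functional_capped_quotient) auto
      finally show ?thesis .
    qed
    with \<mu> show ?thesis
      by blast
  qed
  from weak_star_compact_attains_lower_bounds[OF assms(5) this]
  obtain \<phi> where \<phi>: "\<phi> \<in> measure_functional ` M" "\<And>i. blinfun_apply \<phi> (g i) \<ge> \<rho>"
    by blast
  then obtain k where k: "dist (D k) \<phi> < \<rho> / 2"
    using C(3) D assms(8) closure_approachable[of \<phi> C] by (metis half_gt_zero rangeE subsetD)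
  have "blinfun_apply \<phi> (g k) - blinfun_apply (D k) (g k) \<le> norm (\<phi> - D k) * norm (g k)"
    using norm_blinfun[of "\<phi> - D k" "g k"] by (simp add: minus_blinfun.rep_eq)
  also have "\<dots> \<le> norm (\<phi> - D k)"
    unfolding g_def by (intro mult_left_le norm_capped_quotient_le_1 assms(9) norm_ge_zero)
  also have "\<dots> < \<rho> / 2"
    using k by (simp add: dist_norm norm_minus_commute)
  \<comment> \<open>Stage \<open>2 * k\<close> covers \<open>D k\<close> because
    \<open>k \<le> 2 * k\<close>, so \<open>D k\<close> is below \<open>\<rho> / 2\<close> at
    \<open>g k\<close> while \<open>\<phi>\<close> is at least \<open>\<rho>\<close> there.\<close>
  finally show False
    using \<phi>(2)[of k] small[of "2 * k"] by (auto simp: g_def Q_def dest!: bspec[of _ _ k])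
qed

end
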